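(* Let $\rho\subseteq N^2$ be a binary relation. Then $\widetilde{\rho}$ is a continuous extension of $\rho$ satisfying (RCL); that is, $\widetilde{\rho}\cap N^2=\rho$; for every open set $U\subseteq\beta N$ the set $\widetilde{\rho}^{-1}[U]$ is open in $\beta N$; and for every $q\in\beta N$ the set $\widetilde{\rho}^{-1}[\{q\}]$ is closed in $\beta N$.
   Context: $N=\{1,2,3,\dots\}$ is the set of natural numbers with the discrete topology, and $\beta N$ is its Stone-Čech compactification: the space of all ultrafilters on $N$, with topology generated by the base of (clopen) sets $\bar A=\{p\in\beta N: A\in p\}$, $A\subseteq N$. Each $n\in N$ is identified with the principal ultrafilter $\{A\subseteq N:n\in A\}$, so $N\subseteq\beta N$. For a relation $\sigma\subseteq X^2$ and $A\subseteq X$, $\sigma[A]=\{n\in X:\exists m\in A\ (m,n)\in\sigma\}$ and $\sigma^{-1}[A]=\{m\in X:\exists n\in A\ (m,n)\in\sigma\}$. A relation $\sigma\subseteq(\beta N)^2$ is an extension of $\rho\subseteq N^2$ if the restriction of $\sigma$ to $N^2$ equals $\rho$. For a topological space $X$, a relation $\sigma\subseteq X^2$ is continuous if for every open $U\subseteq X$ the set $\sigma^{-1}[U]$ is open. A relation $\sigma\subseteq X^2$ satisfies (RCL) if for every $q\in X$ the set $\sigma^{-1}[\{q\}]$ is closed. For $\rho\subseteq N^2$, $\widetilde{\rho}=\{(p,q)\in(\beta N)^2:\forall A\in p\ \ \rho[A]\in q\}$. *)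

theory Defs
  imports "HOL-Analysis.Abstract_Topology"
begin

definition NN :: "nat set" where
  "NN = {1..}"

text \<open>
  Ultrafilters on a set \<open>X\<close> are represented by library filters on the ambient type that contain
  \<open>X\<close> (this is \<open>F \<le> principal X\<close>); \<open>members X F\<close> is then the ultrafilter as a family of subsets
  of \<open>X\<close>. The lemma \<open>bij_betw_members\<close> below shows that this representation is faithful.
\<close>

definition ultrafilters :: "'a set \<Rightarrow> 'a filter set" where
  "ultrafilters X = {F. F \<noteq> bot \<and> F \<le> principal X \<and>
     (\<forall>P. eventually P F \<or> eventually (\<lambda>x. \<not> P x) F)}"

definition members :: "'a set \<Rightarrow> 'a filter \<Rightarrow> 'a set set" where
  "members X F = {A. A \<subseteq> X \<and> eventually (\<lambda>x. x \<in> A) F}"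

lemma bij_betw_members:
  "bij_betw (members X) (ultrafilters X)
     {U. U \<subseteq> Pow X \<and> X \<in> U \<and> {} \<notin> U \<and> (\<forall>A\<in>U. \<forall>B\<in>U. A \<inter> B \<in> U) \<and>
         (\<forall>A\<in>U. \<forall>B. A \<subseteq> B \<and> B \<subseteq> X \<longrightarrow> B \<in> U) \<and> (\<forall>A. A \<subseteq> X \<longrightarrow> A \<in> U \<or> X - A \<in> U)}"
    (is "bij_betw _ _ ?S")
proof (rule bij_betw_imageI)
  have ev: "eventually P F \<longleftrightarrow> {x\<in>X. P x} \<in> members X F" if "F \<in> ultrafilters X" for P F
    using that by (auto simp: ultrafilters_def members_def le_principal eventually_conj_iff)
  show "inj_on (members X) (ultrafilters X)"
    by (rule inj_onI) (simp add: filter_eq_iff ev)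
  show "members X ` ultrafilters X = ?S"
  proof (intro set_eqI iffI)
    fix U assume "U \<in> members X ` ultrafilters X"
    then obtain F where F: "F \<in> ultrafilters X" and U: "U = members X F" by auto
    have X: "eventually (\<lambda>x. x \<in> X) F"
      using F by (simp add: ultrafilters_def le_principal)
    have "A \<in> U \<or> X - A \<in> U" if "A \<subseteq> X" for A
      using F that X by (auto simp: U ultrafilters_def members_def eventually_conj_iff)
    moreover have "B \<in> U" if "A \<in> U" "A \<subseteq> B" "B \<subseteq> X" for A B
      using that by (auto simp: U members_def elim: eventually_mono)
    ultimately show "U \<in> ?S"
      using F X by (auto simp: U ultrafilters_def members_def eventually_conj_iff
          trivial_limit_def)
  next
    fix U assume U: "U \<in> ?S"
    define F where "F = Abs_filter (\<lambda>P. {x\<in>X. P x} \<in> U)"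
    have "is_filter (\<lambda>P. {x\<in>X. P x} \<in> U)"
    proof
      show "{x\<in>X. True} \<in> U" using U by simp
      show "{x\<in>X. P x \<and> Q x} \<in> U" if "{x\<in>X. P x} \<in> U" "{x\<in>X. Q x} \<in> U" for P Q
      proof -
        have "{x\<in>X. P x \<and> Q x} = {x\<in>X. P x} \<inter> {x\<in>X. Q x}" by auto
        then show ?thesis using U that by simp
      qed
      show "{x\<in>X. Q x} \<in> U" if "\<forall>x. P x \<longrightarrow> Q x" "{x\<in>X. P x} \<in> U" for P Q
      proof -
        have "{x\<in>X. P x} \<subseteq> {x\<in>X. Q x}" "{x\<in>X. Q x} \<subseteq> X" using that by auto
        then show ?thesis using U that by blast
      qed
    qed
    then have evF: "eventually P F \<longleftrightarrow> {x\<in>X. P x} \<in> U" for P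
      by (simp add: F_def eventually_Abs_filter)
    have "{x\<in>X. P x} \<in> U \<or> {x\<in>X. \<not> P x} \<in> U" for P
    proof -
      have "{x\<in>X. \<not> P x} = X - {x\<in>X. P x}" by auto
      moreover have "{x\<in>X. P x} \<subseteq> X" by auto
      ultimately show ?thesis using U by (metis (mono_tags, lifting) mem_Collect_eq)
    qed
    then have "F \<in> ultrafilters X"
      using U by (simp add: ultrafilters_def trivial_limit_def le_principal evF)
    moreover have "members X F = U"
    proof -
      have "{x \<in> X. x \<in> A} = A" if "A \<subseteq> X" for A using that by auto
      moreover have "A \<subseteq> X" if "A \<in> U" for A using U that by blast
      ultimately show ?thesis
        unfolding members_def evF by (metis (no_types, lifting) Collect_cong Collect_mem_eq)
    qed
    ultimately show "U \<in> members X ` ultrafilters X" by blast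
  qed
qed

definition betaN :: "nat filter set" where
  "betaN = ultrafilters NN"

text \<open>
  \<open>topology_generated_by\<close> takes a subbase; the sets below are closed under finite
  intersections, so they form a base.
\<close>

definition betaN_top :: "nat filter topology" where
  "betaN_top = topology_generated_by {{p \<in> betaN. A \<in> members NN p} | A. A \<subseteq> NN}"

lemma topspace_betaN_top: "topspace betaN_top = betaN"
proof -
  have "NN \<in> members NN p" if "p \<in> betaN" for p
    using that by (simp add: betaN_def ultrafilters_def members_def le_principal)
  then show ?thesis
    unfolding betaN_top_def topology_generated_by_topspace by blast
qed

definition emb :: "nat \<Rightarrow> nat filter" where
  "emb n = principal {n}"

lemma emb_in_betaN: "n \<in> NN \<Longrightarrow> emb n \<in> betaN"
  by (simp add: emb_def betaN_def ultrafilters_def eventually_principal principal_eq_bot_iff)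

lemma members_emb: "members NN (emb n) = {A. A \<subseteq> NN \<and> n \<in> A}"
  by (simp add: members_def emb_def eventually_principal)

lemma inj_emb: "inj emb"
  by (simp add: inj_def emb_def)

text \<open>
  In the following, \<open>\<sigma>[A]\<close> is the library image \<open>\<sigma> `` A\<close> and
  \<open>\<sigma>\<close>-preimages are images under the converse relation.
\<close>

definition is_extension :: "(nat filter \<times> nat filter) set \<Rightarrow> (nat \<times> nat) set \<Rightarrow> bool" where
  "is_extension \<sigma> \<rho> \<longleftrightarrow> \<sigma> \<subseteq> betaN \<times> betaN \<and>
     \<sigma> \<inter> (emb ` NN \<times> emb ` NN) = map_prod emb emb ` \<rho>"

definition continuous_rel :: "'a topology \<Rightarrow> ('a \<times> 'a) set \<Rightarrow> bool" where
  "continuous_rel T \<sigma> \<longleftrightarrow> \<sigma> \<subseteq> topspace T \<times> topspace T \<and>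
     (\<forall>U. openin T U \<longrightarrow> openin T (\<sigma>\<inverse> `` U))"

definition RCL :: "'a topology \<Rightarrow> ('a \<times> 'a) set \<Rightarrow> bool" where
  "RCL T \<sigma> \<longleftrightarrow> \<sigma> \<subseteq> topspace T \<times> topspace T \<and>
     (\<forall>q \<in> topspace T. closedin T (\<sigma>\<inverse> `` {q}))"

definition tilde :: "(nat \<times> nat) set \<Rightarrow> (nat filter \<times> nat filter) set" where
  "tilde \<rho> = {(p, q) \<in> betaN \<times> betaN. \<forall>A \<in> members NN p. \<rho> `` A \<in> members NN q}"

end

theory Submission
  imports Defs
begin

text \<open>
  A relation \<open>\<rho>\<close> transports a filter \<open>p\<close> to the filter \<open>rel_filter \<rho> p\<close> generated by the sets
  \<open>\<rho>[A]\<close>, \<open>A \<in> p\<close>, and \<open>(p, q) \<in> tilde \<rho>\<close> says exactly that the ultrafilter \<open>q\<close> refines it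
  (\<open>in_tilde_iff\<close>). The three claims then become statements about this one filter.

  Extension: the image of the principal ultrafilter at \<open>m\<close> is the principal filter of \<open>\<rho>[{m}]\<close>,
  which the principal ultrafilter at \<open>n\<close> refines iff \<open>(m, n) \<in> \<rho>\<close>.

  Continuity: preimages commute with unions, so basic open sets suffice, and for these the
  preimage is again basic: some \<open>q\<close> containing \<open>B\<close> is related to \<open>p\<close> iff \<open>\<rho>\<inverse>[B] \<in> p\<close>
  (\<open>tilde_converse_Image_basic\<close>). Indeed \<open>\<rho>\<inverse>[B] \<in> p\<close> means that every \<open>\<rho>[A]\<close> with \<open>A \<in> p\<close>
  meets \<open>B\<close>, so that the image filter together with \<open>B\<close> generates a proper filter, and any
  ultrafilter refining that one is a suitable \<open>q\<close>.

  (RCL): if \<open>p\<close> is not related to \<open>q\<close>, a single \<open>A \<in> p\<close> with \<open>\<rho>[A] \<notin> q\<close> witnesses this, and it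
  does so for all ultrafilters in the neighbourhood of \<open>p\<close> determined by \<open>A\<close>.
\<close>

section \<open>Ultrafilters refining a proper filter\<close>

text \<open>
  Refinement is the reverse of inclusion, so an ultrafilter is a minimal proper filter. Zorn's
  lemma supplies one, since the infimum of a chain of proper filters is their union as families of
  sets and hence proper. A minimal \<open>U\<close> decides each \<open>P\<close>: if \<open>\<not> P\<close> is not in \<open>U\<close>, then
  adjoining \<open>P\<close> keeps \<open>U\<close> proper, so \<open>P\<close> was in \<open>U\<close> already.
\<close>

lemma ex_ultrafilter_le:
  fixes F :: "'a filter"
  assumes "F \<noteq> bot"
  shows "\<exists>U\<le>F. U \<noteq> bot \<and> (\<forall>P. eventually P U \<or> eventually (\<lambda>x. \<not> P x) U)"
proof -
  let ?A = "{G. G \<noteq> bot \<and> G \<le> F}"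
  have "\<exists>U\<in>?A. \<forall>G\<in>?A. U \<ge> G \<longrightarrow> G = U"
  proof (rule predicate_Zorn)
    show "partial_order_on ?A (relation_of (\<ge>) ?A)"
      by (rule partial_order_on_relation_ofI) (blast intro: order_trans antisym)+
  next
    fix C assume C: "C \<in> Chains (relation_of (\<ge>) ?A)"
    then have sub: "C \<subseteq> ?A" and chain: "\<And>G H. G \<in> C \<Longrightarrow> H \<in> C \<Longrightarrow> G \<le> H \<or> H \<le> G"
      by (auto simp: Chains_def relation_of_def)
    show "\<exists>u\<in>?A. \<forall>a\<in>C. a \<ge> u"
    proof (cases "C = {}")
      case True
      then show ?thesis using assms by auto
    next
      case False
      have "\<exists>x\<in>C. x \<le> inf G H" if "G \<in> C" "H \<in> C" for G H
        using chain[OF that] that by auto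
      then have "Inf C \<noteq> bot"
        unfolding trivial_limit_def using False sub
        by (subst eventually_Inf_base) (auto simp: trivial_limit_def)
      moreover obtain G where "G \<in> C" "G \<le> F"
        using False sub by blast
      then have "Inf C \<le> F" by (rule Inf_lower2)
      ultimately show ?thesis by (blast intro: Inf_lower)
    qed
  qed
  then obtain U where U: "U \<noteq> bot" "U \<le> F"
    and minimal: "\<forall>G\<in>?A. G \<le> U \<longrightarrow> G = U"
    by blast
  have "eventually P U \<or> eventually (\<lambda>x. \<not> P x) U" for P
  proof (cases "inf U (principal {x. P x}) = bot")
    case True
    then show ?thesis by (simp add: trivial_limit_def eventually_inf_principal)
  next
    case False
    moreover have "inf U (principal {x. P x}) \<le> F" using U(2) by (rule le_infI1)
    ultimately have "inf U (principal {x. P x}) = U" using minimal by simp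
    then have "U \<le> principal {x. P x}" by (metis inf.cobounded2)
    then show ?thesis by (simp add: le_principal)
  qed
  with U show ?thesis by blast
qed

section \<open>The image of a filter under a relation\<close>

definition rel_filter :: "('a \<times> 'b) set \<Rightarrow> 'a filter \<Rightarrow> 'b filter" where
  "rel_filter \<rho> p = Abs_filter (\<lambda>P. eventually (\<lambda>m. \<forall>n. (m, n) \<in> \<rho> \<longrightarrow> P n) p)"

lemma eventually_rel_filter:
  "eventually P (rel_filter \<rho> p) \<longleftrightarrow> eventually (\<lambda>m. \<forall>n. (m, n) \<in> \<rho> \<longrightarrow> P n) p"
  unfolding rel_filter_def
proof (rule eventually_Abs_filter, standard)
  show "eventually (\<lambda>m. \<forall>n. (m, n) \<in> \<rho> \<longrightarrow> P n \<and> Q n) p"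
    if "eventually (\<lambda>m. \<forall>n. (m, n) \<in> \<rho> \<longrightarrow> P n) p"
      and "eventually (\<lambda>m. \<forall>n. (m, n) \<in> \<rho> \<longrightarrow> Q n) p" for P Q
    using that by eventually_elim auto
  show "eventually (\<lambda>m. \<forall>n. (m, n) \<in> \<rho> \<longrightarrow> Q n) p"
    if "\<forall>x. P x \<longrightarrow> Q x" and "eventually (\<lambda>m. \<forall>n. (m, n) \<in> \<rho> \<longrightarrow> P n) p" for P Q
    using that(2) by eventually_elim (use that(1) in auto)
qed simp

text \<open>
  Beyond unfolding definitions, this says that the sets \<open>\<rho>[A]\<close> are a base of the image filter:
  if \<open>P\<close> holds eventually along it, then \<open>A = {m. \<forall>n. (m, n) \<in> \<rho> \<longrightarrow> P n}\<close> is a large set with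
  \<open>P\<close> true throughout \<open>\<rho>[A]\<close>.
\<close>

lemma in_tilde_iff:
  assumes "\<rho> \<subseteq> NN \<times> NN"
  shows "(p, q) \<in> tilde \<rho> \<longleftrightarrow> p \<in> betaN \<and> q \<in> betaN \<and> q \<le> rel_filter \<rho> p"
proof (cases "p \<in> betaN \<and> q \<in> betaN")
  case True
  then have p: "eventually (\<lambda>m. m \<in> NN) p"
    by (simp add: betaN_def ultrafilters_def le_principal)
  have "(\<forall>A\<in>members NN p. \<rho> `` A \<in> members NN q) \<longleftrightarrow> q \<le> rel_filter \<rho> p"
  proof (intro iffI ballI filter_leI)
    fix P
    assume tilde: "\<forall>A\<in>members NN p. \<rho> `` A \<in> members NN q"
      and P: "eventually P (rel_filter \<rho> p)"
    let ?A = "{m \<in> NN. \<forall>n. (m, n) \<in> \<rho> \<longrightarrow> P n}"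
    have "?A \<in> members NN p"
      using P p by (auto simp: members_def eventually_rel_filter eventually_conj_iff)
    then have "eventually (\<lambda>n. n \<in> \<rho> `` ?A) q"
      using tilde by (auto simp: members_def)
    then show "eventually P q"
      by eventually_elim auto
  next
    fix A
    assume le: "q \<le> rel_filter \<rho> p" and "A \<in> members NN p"
    then have "eventually (\<lambda>m. m \<in> A) p" by (simp add: members_def)
    then have "eventually (\<lambda>n. n \<in> \<rho> `` A) (rel_filter \<rho> p)"
      unfolding eventually_rel_filter by eventually_elim auto
    then show "\<rho> `` A \<in> members NN q"
      using le assms by (auto simp: members_def filter_leD)
  qed
  with True show ?thesis by (simp add: tilde_def)
qed (auto simp: tilde_def)

lemma rel_filter_emb: "rel_filter \<rho> (emb m) = principal (\<rho> `` {m})"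
  by (auto simp: filter_eq_iff eventually_rel_filter emb_def eventually_principal)

lemma tilde_extension:
  assumes "\<rho> \<subseteq> NN \<times> NN"
  shows "is_extension (tilde \<rho>) \<rho>"
proof -
  have "(emb m, emb n) \<in> tilde \<rho> \<longleftrightarrow> (m, n) \<in> \<rho>" if "m \<in> NN" "n \<in> NN" for m n
    using that emb_in_betaN
    by (simp add: in_tilde_iff[OF assms] rel_filter_emb)
      (simp add: emb_def)
  then have "tilde \<rho> \<inter> (emb ` NN \<times> emb ` NN) = map_prod emb emb ` \<rho>"
    using assms by (fastforce simp: map_prod_def)
  then show ?thesis by (auto simp: is_extension_def tilde_def)
qed

section \<open>Preimages of open sets and of points\<close>

lemma openin_basic:
  assumes "A \<subseteq> NN"
  shows "openin betaN_top {p \<in> betaN. A \<in> members NN p}"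
  unfolding betaN_top_def using assms by (intro topology_generated_by_Basis) auto

text \<open>
  The subbase in the definition of the topology is a base because membership in an ultrafilter
  respects finite intersections.
\<close>

lemma ex_basic_nhd:
  assumes "openin betaN_top U" and "q \<in> U"
  shows "\<exists>B\<subseteq>NN. B \<in> members NN q \<and> {p \<in> betaN. B \<in> members NN p} \<subseteq> U"
proof -
  have "generate_topology_on {{p \<in> betaN. A \<in> members NN p} | A. A \<subseteq> NN} U"
    using assms(1) unfolding betaN_top_def by (rule openin_topology_generated_by)
  then show ?thesis using assms(2)
  proof (induction arbitrary: q)
    case Empty
    then show ?case by simp
  next
    case (Int a b)
    from Int.IH[of q] Int.prems obtain B C
      where B: "B \<subseteq> NN" "B \<in> members NN q" "{p \<in> betaN. B \<in> members NN p} \<subseteq> a"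
        and C: "C \<subseteq> NN" "C \<in> members NN q" "{p \<in> betaN. C \<in> members NN p} \<subseteq> b"
      by auto
    have "B \<inter> C \<in> members NN p \<longleftrightarrow> B \<in> members NN p \<and> C \<in> members NN p" for p
      using B(1) C(1) by (auto simp: members_def eventually_conj_iff)
    with B C show ?case by (intro exI[of _ "B \<inter> C"]) auto
  next
    case (UN K)
    then show ?case by (meson UnionE Union_upper order_trans)
  next
    case (Basis s)
    then show ?case by auto
  qed
qed

text \<open>
  The core of the argument, and the only place where a new ultrafilter has to be found: \<open>q\<close> must
  refine both the image filter of \<open>p\<close> and the principal filter of \<open>B\<close>. Their infimum is improper
  iff \<open>p\<close>-almost all \<open>m\<close> have no \<open>\<rho>\<close>-successor in \<open>B\<close>, that is, iff the complement of
  \<open>\<rho>\<inverse>[B]\<close> is in \<open>p\<close>.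
\<close>

lemma tilde_converse_Image_basic:
  assumes \<rho>: "\<rho> \<subseteq> NN \<times> NN" and B: "B \<subseteq> NN"
  shows "(tilde \<rho>)\<inverse> `` {q \<in> betaN. B \<in> members NN q} = {p \<in> betaN. \<rho>\<inverse> `` B \<in> members NN p}"
proof (intro set_eqI)
  fix p
  let ?G = "inf (rel_filter \<rho> p) (principal B)"
  have "p \<in> (tilde \<rho>)\<inverse> `` {q \<in> betaN. B \<in> members NN q} \<longleftrightarrow>
      p \<in> betaN \<and> (\<exists>q\<in>betaN. q \<le> ?G)"
    using B by (auto simp: in_tilde_iff[OF \<rho>] members_def le_principal)
  also have "(\<exists>q\<in>betaN. q \<le> ?G) \<longleftrightarrow> ?G \<noteq> bot"
  proof
    assume "\<exists>q\<in>betaN. q \<le> ?G"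
    then obtain q where "q \<noteq> bot" "q \<le> ?G"
      unfolding betaN_def ultrafilters_def by blast
    then show "?G \<noteq> bot" by (metis bot_unique)
  next
    assume "?G \<noteq> bot"
    then obtain q where q: "q \<noteq> bot" "q \<le> ?G"
        "\<forall>P. eventually P q \<or> eventually (\<lambda>x. \<not> P x) q"
      using ex_ultrafilter_le by blast
    have "q \<le> principal B" using q(2) by simp
    also have "\<dots> \<le> principal NN" using B by simp
    finally have "q \<in> betaN" using q by (simp add: betaN_def ultrafilters_def)
    with q(2) show "\<exists>q\<in>betaN. q \<le> ?G" by blast
  qed
  also have "p \<in> betaN \<and> ?G \<noteq> bot \<longleftrightarrow> p \<in> betaN \<and> \<rho>\<inverse> `` B \<in> members NN p"
  proof (rule conj_cong[OF refl])
    assume p: "p \<in> betaN"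
    have "?G = bot \<longleftrightarrow> eventually (\<lambda>m. m \<notin> \<rho>\<inverse> `` B) p"
      unfolding trivial_limit_def eventually_inf_principal eventually_rel_filter
      by (rule arg_cong[where f = "\<lambda>P. eventually P p"]) auto
    also have "\<dots> \<longleftrightarrow> \<not> eventually (\<lambda>m. m \<in> \<rho>\<inverse> `` B) p"
    proof
      assume "eventually (\<lambda>m. m \<notin> \<rho>\<inverse> `` B) p"
      then show "\<not> eventually (\<lambda>m. m \<in> \<rho>\<inverse> `` B) p"
        using p by (auto simp: betaN_def ultrafilters_def trivial_limit_def
            dest: eventually_conj)
    next
      assume "\<not> eventually (\<lambda>m. m \<in> \<rho>\<inverse> `` B) p"
      then show "eventually (\<lambda>m. m \<notin> \<rho>\<inverse> `` B) p"
        using p unfolding betaN_def ultrafilters_def by blast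
    qed
    finally show "?G \<noteq> bot \<longleftrightarrow> \<rho>\<inverse> `` B \<in> members NN p"
      using \<rho> by (auto simp: members_def)
  qed
  finally show "p \<in> (tilde \<rho>)\<inverse> `` {q \<in> betaN. B \<in> members NN q} \<longleftrightarrow>
      p \<in> {p \<in> betaN. \<rho>\<inverse> `` B \<in> members NN p}"
    by simp
qed

lemma tilde_continuous:
  assumes "\<rho> \<subseteq> NN \<times> NN"
  shows "continuous_rel betaN_top (tilde \<rho>)"
  unfolding continuous_rel_def
proof (intro conjI allI impI)
  show "tilde \<rho> \<subseteq> topspace betaN_top \<times> topspace betaN_top"
    by (auto simp: tilde_def topspace_betaN_top)
next
  fix U assume U: "openin betaN_top U"
  show "openin betaN_top ((tilde \<rho>)\<inverse> `` U)"
  proof (subst openin_subopen, intro ballI)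
    fix p assume "p \<in> (tilde \<rho>)\<inverse> `` U"
    then obtain q where q: "q \<in> U" "(p, q) \<in> tilde \<rho>" by auto
    from ex_basic_nhd[OF U q(1)] obtain B
      where B: "B \<subseteq> NN" "B \<in> members NN q" "{p \<in> betaN. B \<in> members NN p} \<subseteq> U"
      by auto
    let ?V = "(tilde \<rho>)\<inverse> `` {q \<in> betaN. B \<in> members NN q}"
    have "openin betaN_top ?V"
      unfolding tilde_converse_Image_basic[OF assms B(1)]
      using assms by (intro openin_basic) auto
    moreover have "p \<in> ?V"
      using q(2) B(2) by (auto simp: tilde_def)
    moreover have "?V \<subseteq> (tilde \<rho>)\<inverse> `` U"
      using B(3) by (rule Image_mono[OF subset_refl])
    ultimately show "\<exists>V. openin betaN_top V \<and> p \<in> V \<and> V \<subseteq> (tilde \<rho>)\<inverse> `` U"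
      by blast
  qed
qed

lemma tilde_RCL: "RCL betaN_top (tilde \<rho>)"
  unfolding RCL_def
proof (intro conjI ballI)
  show "tilde \<rho> \<subseteq> topspace betaN_top \<times> topspace betaN_top"
    by (auto simp: tilde_def topspace_betaN_top)
next
  fix q assume q: "q \<in> topspace betaN_top"
  have members_subset: "A \<subseteq> NN" if "A \<in> members NN p" for A p
    using that by (simp add: members_def)
  have "betaN - (tilde \<rho>)\<inverse> `` {q} =
      \<Union> {{p \<in> betaN. A \<in> members NN p} | A. A \<subseteq> NN \<and> \<rho> `` A \<notin> members NN q}"
    using q members_subset unfolding tilde_def topspace_betaN_top by blast
  also have "openin betaN_top \<dots>"
    by (rule openin_Union) (auto intro: openin_basic)
  finally show "closedin betaN_top ((tilde \<rho>)\<inverse> `` {q})"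
    by (auto simp: closedin_def topspace_betaN_top tilde_def)
qed

theorem theorem2p8:
  fixes \<rho> :: "(nat \<times> nat) set"
  assumes "\<rho> \<subseteq> NN \<times> NN"
  shows "is_extension (tilde \<rho>) \<rho> \<and> continuous_rel betaN_top (tilde \<rho>) \<and> RCL betaN_top (tilde \<rho>)"
  using tilde_extension[OF assms] tilde_continuous[OF assms] tilde_RCL by blast

end
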